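(* Let $C$ be a nontrivial cyclic group (finite or infinite). Then for every finite symmetric generating set $S$ of $\mathbb{Z}^2\times C$ not containing the identity, the Cayley graph $\mathrm{Cay}(\mathbb{Z}^2\times C,S)$ is not minor excluded.
   Context: Cayley graph: for a group $G$ and a finite generating set $S$ that is symmetric ($s\in S$ iff $s^{-1}\in S$) and does not contain the identity, $\mathrm{Cay}(G,S)$ is the graph with vertex set $G$ in which $u,v\in G$ are adjacent if and only if $u=sv$ for some $s\in S$. Minor: a finite graph $M$ is a minor of a connected graph $\Gamma$ if there is a finite set $\{V_i\}$ of pairwise-disjoint (nonempty) finite connected subgraphs of $\Gamma$ (branch sets), in one-to-one correspondence with the set of vertices $\{v_i\}$ of $M$, such that for every edge of $M$ between $v_i$ and $v_j$ there is an edge of $\Gamma$ between $V_i$ and $V_j$. The graph $\Gamma$ is minor excluded if there is a finite graph that is not a minor of $\Gamma$; equivalently, if there is a natural number $m$ such that the complete graph $K_m$ is not a minor of $\Gamma$. *)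

theory Defs
  imports "HOL-Algebra.Algebra" "Graph_Theory.Digraph_Component"
begin

text \<open>
  An undirected graph is a symmetric digraph, an edge being a pair of opposite arcs. The locale
  \<open>pair_graph\<close> of \<open>Graph_Theory\<close> describes the finite simple graphs.
\<close>

definition symmetric_generating_set :: "('a, 'm) monoid_scheme \<Rightarrow> 'a set \<Rightarrow> bool" where
  "symmetric_generating_set G S \<longleftrightarrow>
     S \<subseteq> carrier G \<and> generate G S = carrier G \<and>
     (\<forall>s \<in> carrier G. s \<in> S \<longleftrightarrow> inv\<^bsub>G\<^esub> s \<in> S)"

definition cayley_graph :: "('a, 'm) monoid_scheme \<Rightarrow> 'a set \<Rightarrow> 'a pair_pre_digraph" where
  "cayley_graph G S =
     \<lparr> pverts = carrier G,
       parcs = {(u, v). u \<in> carrier G \<and> v \<in> carrier G \<and> (\<exists>s \<in> S. u = s \<otimes>\<^bsub>G\<^esub> v)} \<rparr>"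

text \<open>
  Branch sets are nonempty because \<open>connected\<close>, the notion of \<open>Graph_Theory\<close>, excludes the graph
  without vertices.
\<close>

definition is_minor :: "'b pair_pre_digraph \<Rightarrow> 'a pair_pre_digraph \<Rightarrow> bool" where
  "is_minor M \<Gamma> \<longleftrightarrow>
     (\<exists>V :: 'b \<Rightarrow> 'a pair_pre_digraph.
        (\<forall>x \<in> pverts M.
           pair_graph (V x) \<and> subgraph (with_proj (V x)) (with_proj \<Gamma>) \<and>
           Digraph_Component.connected (with_proj (V x))) \<and>
        (\<forall>x \<in> pverts M. \<forall>y \<in> pverts M. x \<noteq> y \<longrightarrow> pverts (V x) \<inter> pverts (V y) = {}) \<and>
        (\<forall>(x, y) \<in> parcs M. \<exists>u \<in> pverts (V x). \<exists>v \<in> pverts (V y). (u, v) \<in> parcs \<Gamma>))"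

text \<open>
  Every finite graph is isomorphic to one whose vertices are natural numbers, so letting \<open>M\<close>
  range over the latter is no restriction.
\<close>

definition minor_excluded :: "'a pair_pre_digraph \<Rightarrow> bool" where
  "minor_excluded \<Gamma> \<longleftrightarrow> (\<exists>M :: nat pair_pre_digraph. pair_graph M \<and> \<not> is_minor M \<Gamma>)"

end

theory Submission
  imports Defs
begin

text \<open>
  Choose \<open>a, b \<in> S\<close> whose projections to \<open>\<int>\<^sup>2\<close> are linearly independent. The subgroup \<open>A\<close> they generate
  meets \<open>{0} \<times> C\<close> trivially, so it is proper and some \<open>s \<in> S\<close> lies outside it. Thus \<open>A\<close> and its coset
  \<open>s A\<close> carry two disjoint grids, which \<open>s\<close> joins vertex by vertex. Row \<open>i\<close> of the first grid together
  with column \<open>i\<close> of the second is a connected set, and any two such sets are adjacent because row \<open>i\<close>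
  crosses column \<open>j\<close> at \<open>(i, j)\<close>. Hence every complete graph is a minor.
\<close>

section \<open>Induced subgraphs as branch sets, and complete minors in a two-layer grid\<close>

definition induced_pair_graph :: "'a pair_pre_digraph \<Rightarrow> 'a set \<Rightarrow> 'a pair_pre_digraph" where
  "induced_pair_graph \<Gamma> W = \<lparr> pverts = W, parcs = parcs \<Gamma> \<inter> W \<times> W \<rparr>"

lemma pverts_induced_pair_graph [simp]: "pverts (induced_pair_graph \<Gamma> W) = W"
  and parcs_induced_pair_graph [simp]: "parcs (induced_pair_graph \<Gamma> W) = parcs \<Gamma> \<inter> W \<times> W"
  by (simp_all add: induced_pair_graph_def)

context pair_bidirected_digraph
begin

lemma pair_graph_induced:
  assumes "finite W"
  shows "pair_graph (induced_pair_graph G W)"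
proof
  show "symmetric (with_proj (induced_pair_graph G W))"
    using pair_sym_arcs by (auto simp: symmetric_def sym_def)
qed (auto simp: assms dest: pair_no_loops)

lemma subgraph_induced:
  assumes "W \<subseteq> pverts G"
  shows "subgraph (with_proj (induced_pair_graph G W)) (with_proj G)"
proof -
  have "pair_wf_digraph (induced_pair_graph G W)"
    by unfold_locales auto
  then show ?thesis
    using assms wf_digraph by (auto simp: subgraph_def compatible_def wf_digraph_wp_iff)
qed

text \<open>Arcs can be reversed, so any two vertices are joined through the hub \<open>z\<close>;
  its membership in \<open>W\<close> also rules out the empty graph.\<close>

lemma connected_inducedI:
  assumes "finite W" "z \<in> W"
    and "\<And>u. u \<in> W \<Longrightarrow> u \<rightarrow>\<^sup>*\<^bsub>with_proj (induced_pair_graph G W)\<^esub> z"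
  shows "Digraph_Component.connected (with_proj (induced_pair_graph G W))"
proof -
  interpret H: pair_graph "induced_pair_graph G W"
    by (rule pair_graph_induced) fact
  have "u \<rightarrow>\<^sup>*\<^bsub>with_proj (induced_pair_graph G W)\<^esub> v" if "u \<in> W" "v \<in> W" for u v
    using H.reachable_trans[OF assms(3) H.symmetric_reachable'[OF assms(3)]] that .
  with assms(2) show ?thesis
    unfolding Digraph_Component.connected_def
    by (intro strongly_connectedI) (auto simp: H.reachable_mk_symmetricI)
qed

text \<open>Meant for rows and columns of a grid, cut off after \<open>m\<close> vertices. Running
  back to \<open>f 0\<close> and out again treats \<open>j \<le> k\<close> and
  \<open>k \<le> j\<close> alike.\<close>

lemma path_reachable_induced:
  assumes "finite W" and "f ` {..<m} \<subseteq> W"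
    and "\<And>j. (f j, f (Suc j)) \<in> parcs G" and "j < m" "k < m"
  shows "f j \<rightarrow>\<^sup>*\<^bsub>with_proj (induced_pair_graph G W)\<^esub> f k"
proof -
  interpret H: pair_graph "induced_pair_graph G W"
    by (rule pair_graph_induced) fact
  have from_0: "f 0 \<rightarrow>\<^sup>*\<^bsub>with_proj (induced_pair_graph G W)\<^esub> f i" if "i < m" for i
    using that
  proof (induction i)
    case 0
    then show ?case using assms(2) by (intro H.reachable_refl) auto
  next
    case (Suc i)
    then have "f 0 \<rightarrow>\<^sup>*\<^bsub>with_proj (induced_pair_graph G W)\<^esub> f i" by simp
    moreover have "(f i, f (Suc i)) \<in> parcs (induced_pair_graph G W)"
      using Suc.prems assms(2,3) by auto
    ultimately show ?case by (rule H.reachable_adj_trans)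
  qed
  show ?thesis
    using H.reachable_trans[OF H.symmetric_reachable'[OF from_0] from_0] assms(4,5) .
qed

text \<open>A branch set follows a row of the layer \<open>p\<close> and a column of the layer
  \<open>q\<close>, hence the shape of \<open>row\<close> and \<open>column\<close>. The layers are
  infinite quadrants, so one pair of them serves every \<open>M\<close>.\<close>

lemma two_layer_grid_not_minor_excluded:
  fixes p q :: "nat \<Rightarrow> nat \<Rightarrow> 'a"
  assumes row: "\<And>i j. (p i j, p i (Suc j)) \<in> parcs G"
    and column: "\<And>i j. (q i j, q (Suc i) j) \<in> parcs G"
    and rung: "\<And>i j. (p i j, q i j) \<in> parcs G"
    and inj_p: "\<And>i j i' j'. p i j = p i' j' \<Longrightarrow> i = i' \<and> j = j'"
    and inj_q: "\<And>i j i' j'. q i j = q i' j' \<Longrightarrow> i = i' \<and> j = j'"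
    and disj: "\<And>i j i' j'. p i j \<noteq> q i' j'"
  shows "\<not> minor_excluded G"
  unfolding minor_excluded_def
proof (intro notI, elim exE conjE)
  fix M :: "nat pair_pre_digraph"
  assume "pair_graph M" and no_minor: "\<not> is_minor M G"
  interpret M: pair_graph M by fact
  \<comment> \<open>The vertices of \<open>M\<close> serve as row and column numbers, so an
    \<open>m\<close> by \<open>m\<close> corner of each layer contains all crossings.\<close>
  obtain m where m: "pverts M \<subseteq> {..<m}"
    using M.pair_finite_verts finite_nat_iff_bounded by blast
  define W where "W i = p i ` {..<m} \<union> (\<lambda>j. q j i) ` {..<m}" for i
  define V where "V i = induced_pair_graph G (W i)" for i
  have fin: "finite (W i)" for i
    by (simp add: W_def)
  have sub: "W i \<subseteq> pverts G" for i
    using in_arcsD1[OF row] in_arcsD1[OF column] by (auto simp: W_def)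
  have conn: "Digraph_Component.connected (with_proj (V i))" if "i < m" for i
    unfolding V_def
  proof (rule connected_inducedI)
    show "finite (W i)" by (fact fin)
    \<comment> \<open>The hub is the upper end of the diagonal rung, which links row
      \<open>i\<close> to column \<open>i\<close>; \<open>i < m\<close> keeps this rung inside the
      truncated paths.\<close>
    show "q i i \<in> W i" using that by (auto simp: W_def)
    interpret H: pair_graph "induced_pair_graph G (W i)"
      by (rule pair_graph_induced) (fact fin)
    fix u assume "u \<in> W i"
    then consider j where "j < m" "u = p i j" | j where "j < m" "u = q j i"
      by (auto simp: W_def)
    then show "u \<rightarrow>\<^sup>*\<^bsub>with_proj (induced_pair_graph G (W i))\<^esub> q i i"
    proof cases
      case 1
      then have "u \<rightarrow>\<^sup>*\<^bsub>with_proj (induced_pair_graph G (W i))\<^esub> p i i"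
        using path_reachable_induced[where f = "p i" and m = m, OF fin _ row] that by (simp add: W_def)
      moreover have "(p i i, q i i) \<in> parcs (induced_pair_graph G (W i))"
        using rung that by (auto simp: W_def)
      ultimately show ?thesis by (rule H.reachable_adj_trans)
    next
      case 2
      then show ?thesis
        using path_reachable_induced[where f = "\<lambda>j. q j i" and m = m, OF fin _ column] that
        by (simp add: W_def)
    qed
  qed
  have "is_minor M G"
    unfolding is_minor_def
  proof (intro exI[of _ V] conjI ballI impI)
    fix x assume "x \<in> pverts M"
    then show "Digraph_Component.connected (with_proj (V x))"
      using m conn by auto
    show "pair_graph (V x)" "subgraph (with_proj (V x)) (with_proj G)"
      unfolding V_def by (rule pair_graph_induced[OF fin] subgraph_induced[OF sub])+
  next
    fix x y :: nat
    assume "x \<noteq> y"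
    then show "pverts (V x) \<inter> pverts (V y) = {}"
      using inj_p inj_q disj disj[symmetric] by (fastforce simp: V_def W_def)
  next
    fix e assume "e \<in> parcs M"
    then obtain x y where e: "e = (x, y)" "x < m" "y < m"
      using m M.in_arcsD1 M.in_arcsD2 by (cases e) blast
    \<comment> \<open>The rung at \<open>(x, y)\<close> leaves row \<open>x\<close> of the first
      layer and ends in column \<open>y\<close> of the second.\<close>
    then have "p x y \<in> pverts (V x)" "q x y \<in> pverts (V y)"
      by (auto simp: V_def W_def)
    with rung show "case e of (x, y) \<Rightarrow> \<exists>u\<in>pverts (V x). \<exists>v\<in>pverts (V y). (u, v) \<in> parcs G"
      using e by blast
  qed
  with no_minor show False ..
qed

end

section \<open>Grids in Cayley graphs of abelian groups\<close>

lemma parcs_cayley_graph_iff: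
  "(u, v) \<in> parcs (cayley_graph G S) \<longleftrightarrow>
    u \<in> carrier G \<and> v \<in> carrier G \<and> (\<exists>s \<in> S. u = s \<otimes>\<^bsub>G\<^esub> v)"
  by (simp add: cayley_graph_def)

lemma (in group) pair_bidirected_digraph_cayley_graph:
  assumes "symmetric_generating_set G S" and "\<one> \<notin> S"
  shows "pair_bidirected_digraph (cayley_graph G S)"
proof
  have S: "S \<subseteq> carrier G"
    using assms(1) by (simp add: symmetric_generating_set_def)
  have inv_S: "inv s \<in> S" if "s \<in> S" for s
    using assms(1) that by (auto simp: symmetric_generating_set_def)
  show "symmetric (with_proj (cayley_graph G S))"
    unfolding symmetric_def with_proj_simps
  proof (rule symI)
    fix u v assume "(u, v) \<in> parcs (cayley_graph G S)"
    then obtain s where s: "u \<in> carrier G" "v \<in> carrier G" "s \<in> S" "u = s \<otimes> v"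
      unfolding parcs_cayley_graph_iff by blast
    moreover from this S have "s \<in> carrier G"
      by blast
    ultimately have "v = inv s \<otimes> u"
      using inv_solve_left[of v s u] by blast
    with s inv_S show "(v, u) \<in> parcs (cayley_graph G S)"
      unfolding parcs_cayley_graph_iff by blast
  qed
  show "fst e \<noteq> snd e" if "e \<in> parcs (cayley_graph G S)" for e
  proof
    assume "fst e = snd e"
    with that have "(snd e, snd e) \<in> parcs (cayley_graph G S)"
      by (metis prod.collapse)
    then obtain s v where s: "v \<in> carrier G" "s \<in> S" "v = s \<otimes> v"
      unfolding parcs_cayley_graph_iff by blast
    with S have "s = \<one>"
      using r_cancel_one'[of v s] by blast
    with s(2) assms(2) show False by simp
  qed
qed (auto simp: cayley_graph_def)

text \<open>Commutativity collects the powers of \<open>a\<close> and of \<open>b\<close>, so these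
  products are already closed. The explicit form turns membership into a question about
  exponents.\<close>

lemma (in comm_group) subgroup_two_generators:
  assumes "a \<in> carrier G" "b \<in> carrier G"
  shows "subgroup {a [^] i \<otimes> b [^] j |(i::int) (j::int). True} G" (is "subgroup ?A G")
proof (rule subgroupI)
  show "?A \<subseteq> carrier G" using assms by auto
  show "?A \<noteq> {}" by auto
next
  fix x assume "x \<in> ?A"
  then obtain i j :: int where "x = a [^] i \<otimes> b [^] j" by blast
  then have "inv x = a [^] (- i) \<otimes> b [^] (- j)"
    using assms by (simp add: inv_mult int_pow_neg)
  then show "inv x \<in> ?A" by blast
next
  fix x y assume "x \<in> ?A" "y \<in> ?A"
  then obtain i j k l :: int where "x = a [^] i \<otimes> b [^] j" "y = a [^] k \<otimes> b [^] l" by blast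
  then have "x \<otimes> y = a [^] (i + k) \<otimes> b [^] (j + l)"
    using assms by (simp add: int_pow_mult m_ac)
  then show "x \<otimes> y \<in> ?A" by blast
qed

lemma (in comm_group) cayley_graph_not_minor_excluded:
  assumes sym: "symmetric_generating_set G S" and "\<one> \<notin> S"
    and in_S: "a \<in> S" "b \<in> S" "s \<in> S"
    and indep: "\<And>(i :: int) (j :: int). a [^] i \<otimes> b [^] j = \<one> \<Longrightarrow> i = 0 \<and> j = 0"
    and s: "\<And>(i :: int) (j :: int). s \<noteq> a [^] i \<otimes> b [^] j"
  shows "\<not> minor_excluded (cayley_graph G S)"
proof -
  interpret \<Gamma>: pair_bidirected_digraph "cayley_graph G S"
    using sym \<open>\<one> \<notin> S\<close> by (rule pair_bidirected_digraph_cayley_graph)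
  have closed: "a \<in> carrier G" "b \<in> carrier G" "s \<in> carrier G"
    using sym in_S by (auto simp: symmetric_generating_set_def)
  have arc: "(v, t \<otimes> v) \<in> parcs (cayley_graph G S)" if "t \<in> S" "v \<in> carrier G" for t v
  proof (rule \<Gamma>.arcs_symmetric)
    have "t \<in> carrier G"
      using that sym by (auto simp: symmetric_generating_set_def)
    with that show "(t \<otimes> v, v) \<in> parcs (cayley_graph G S)"
      by (auto simp: cayley_graph_def)
  qed
  \<comment> \<open>Natural exponents parametrize a quadrant; left multiplication by
    \<open>b\<close> moves along a row, by \<open>a\<close> along a column.\<close>
  define p where "p i j = a [^] i \<otimes> b [^] j" for i j :: nat
  have p_closed: "p i j \<in> carrier G" for i j
    using closed by (simp add: p_def)
  \<comment> \<open>Injectivity and disjointness of the layers both concern such a quotient: if it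
    is \<open>\<one>\<close>, \<open>indep\<close> equates the indices, and it cannot be
    \<open>s\<close>, which is no product of powers of \<open>a\<close> and
    \<open>b\<close>.\<close>
  have quotient: "p i j \<otimes> inv (p k l) = a [^] (int i - int k) \<otimes> b [^] (int j - int l)" for i j k l
    using closed by (simp add: p_def int_pow_diff int_pow_int inv_mult m_ac)
  have inj_p: "i = k \<and> j = l" if "p i j = p k l" for i j k l
    using indep[of "int i - int k" "int j - int l"] quotient[of i j k l] that p_closed by simp
  show ?thesis
  proof (rule \<Gamma>.two_layer_grid_not_minor_excluded[of p "\<lambda>i j. s \<otimes> p i j"])
    fix i j
    have "p i (Suc j) = b \<otimes> p i j" and "p (Suc i) j = a \<otimes> p i j"
      using closed by (simp_all add: p_def m_ac)
    \<comment> \<open>Commutativity moves \<open>a\<close> past \<open>s\<close>, so the translate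
      by \<open>s\<close> is again a grid for left multiplication.\<close>
    moreover from this closed p_closed have "s \<otimes> p (Suc i) j = a \<otimes> (s \<otimes> p i j)"
      by (simp add: m_lcomm)
    ultimately show "(p i j, p i (Suc j)) \<in> parcs (cayley_graph G S)"
      and "(s \<otimes> p i j, s \<otimes> p (Suc i) j) \<in> parcs (cayley_graph G S)"
      and "(p i j, s \<otimes> p i j) \<in> parcs (cayley_graph G S)"
      using in_S closed p_closed by (simp_all add: arc)
  next
    fix i j k l
    show "i = k \<and> j = l" if "p i j = p k l"
      using that by (rule inj_p)
    show "i = k \<and> j = l" if "s \<otimes> p i j = s \<otimes> p k l"
      using that closed p_closed by (intro inj_p) simp
    show "p i j \<noteq> s \<otimes> p k l"
    proof
      assume "p i j = s \<otimes> p k l"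
      then have "s = p i j \<otimes> inv (p k l)"
        using closed p_closed by (simp add: inv_solve_right)
      with quotient s show False by metis
    qed
  qed
qed

section \<open>Independent generators in the product of the integer plane with
  \<open>C\<close>\<close>

lemma (in group) hom_integer_group_nonzero_on_generators:
  assumes "h \<in> hom G integer_group" and "S \<subseteq> carrier G" "generate G S = carrier G"
    and "x \<in> carrier G" "h x \<noteq> 0"
  obtains s where "s \<in> S" "h s \<noteq> 0"
proof -
  interpret h: group_hom G integer_group h
    using assms(1) by (simp add: group_hom_def group_hom_axioms_def)
  \<comment> \<open>Otherwise the kernel, being a subgroup, would contain everything that
    \<open>S\<close> generates, including \<open>x\<close>.\<close>
  have "\<not> S \<subseteq> kernel G integer_group h"
    using generate_subgroup_incl[OF _ h.subgroup_kernel, of S] assms(3-5)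
    by (auto simp: kernel_def)
  with assms(2) that show thesis
    by (auto simp: kernel_def)
qed

theorem lemma3p2:
  fixes C :: "('c, 'm) monoid_scheme"
    and S :: "((int \<times> int) \<times> 'c) set"
  assumes "group C" and "cyclic_group C" and "\<not> trivial_group C"
    and "finite S"
    and "symmetric_generating_set ((integer_group \<times>\<times> integer_group) \<times>\<times> C) S"
    and "\<one>\<^bsub>(integer_group \<times>\<times> integer_group) \<times>\<times> C\<^esub> \<notin> S"
  shows "\<not> minor_excluded (cayley_graph ((integer_group \<times>\<times> integer_group) \<times>\<times> C) S)"
proof -
  let ?G = "(integer_group \<times>\<times> integer_group) \<times>\<times> C"
  interpret C: comm_group C
    using assms(1,2) by (rule group.cyclic_imp_abelian_group)
  interpret G: group ?G
    by (intro DirProd_group group_integer_group C.is_group)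
  interpret G: comm_group ?G
    by (rule G.group_comm_groupI) (auto simp: C.m_comm)
  have S: "S \<subseteq> carrier ?G" "generate ?G S = carrier ?G"
    using assms(5) by (auto simp: symmetric_generating_set_def)
  \<comment> \<open>The determinant of the two planar parts: nonzero exactly when they are linearly
    independent, and for fixed \<open>x\<close> a homomorphism to the integers.\<close>
  define det :: "(int \<times> int) \<times> 'c \<Rightarrow> (int \<times> int) \<times> 'c \<Rightarrow> int" where
    "det x y = fst (fst x) * snd (fst y) - snd (fst x) * fst (fst y)" for x y
  have det_hom: "det x \<in> hom ?G integer_group" for x
    by (auto simp: hom_def det_def algebra_simps)
  have det_power: "det x (a [^]\<^bsub>?G\<^esub> i \<otimes>\<^bsub>?G\<^esub> b [^]\<^bsub>?G\<^esub> j) = i * det x a + j * det x b"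
    if "a \<in> carrier ?G" "b \<in> carrier ?G" for x a b and i j :: int
  proof -
    interpret D: group_hom ?G integer_group "det x"
      using det_hom by (simp add: group_hom_def group_hom_axioms_def G.is_group)
    have "det x (a [^]\<^bsub>?G\<^esub> i \<otimes>\<^bsub>?G\<^esub> b [^]\<^bsub>?G\<^esub> j) =
        det x (a [^]\<^bsub>?G\<^esub> i) \<otimes>\<^bsub>integer_group\<^esub> det x (b [^]\<^bsub>?G\<^esub> j)"
      using that by (intro D.hom_mult G.int_pow_closed)
    then show ?thesis
      unfolding D.hom_int_pow[OF that(1)] D.hom_int_pow[OF that(2)] by simp
  qed
  \<comment> \<open>The first coordinate of \<open>a\<close> is made nonzero because it equals
    \<open>det a ((0, 1), \<one>)\<close>; this shows that \<open>det a\<close> is not the zero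
    homomorphism when \<open>b\<close> is chosen.\<close>
  obtain a where a: "a \<in> S" "fst (fst a) \<noteq> 0"
  proof (rule G.hom_integer_group_nonzero_on_generators[of "\<lambda>x. fst (fst x)"])
    show "(\<lambda>x. fst (fst x)) \<in> hom ?G integer_group" by (auto simp: hom_def)
    show "((1, 0), \<one>\<^bsub>C\<^esub>) \<in> carrier ?G" by simp
  qed (use S in auto)
  obtain b where b: "b \<in> S" "det a b \<noteq> 0"
  proof (rule G.hom_integer_group_nonzero_on_generators[OF det_hom[of a] S])
    show "((0, 1), \<one>\<^bsub>C\<^esub>) \<in> carrier ?G" by simp
    show "det a ((0, 1), \<one>\<^bsub>C\<^esub>) \<noteq> 0" using a by (simp add: det_def)
  qed
  have closed: "a \<in> carrier ?G" "b \<in> carrier ?G"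
    using a b S by auto
  \<comment> \<open>Cramer's rule: pairing with \<open>a\<close> leaves
    \<open>j * det a b = 0\<close>, pairing with \<open>b\<close> leaves
    \<open>i * det b a = 0\<close>. Assuming only that the planar part vanishes makes this apply to
    \<open>((0, 0), c)\<close> as well as to the identity.\<close>
  have indep: "i = 0 \<and> j = 0"
    if "fst (a [^]\<^bsub>?G\<^esub> i \<otimes>\<^bsub>?G\<^esub> b [^]\<^bsub>?G\<^esub> j) = (0, 0)" for i j :: int
  proof -
    have "det x (a [^]\<^bsub>?G\<^esub> i \<otimes>\<^bsub>?G\<^esub> b [^]\<^bsub>?G\<^esub> j) = 0" for x
      using that by (simp add: det_def)
    then have "i * det x a + j * det x b = 0" for x
      using det_power[OF closed] by simp
    from this[of a] this[of b] b(2) show ?thesis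
      by (simp add: det_def algebra_simps)
  qed
  let ?A = "{a [^]\<^bsub>?G\<^esub> i \<otimes>\<^bsub>?G\<^esub> b [^]\<^bsub>?G\<^esub> j |(i::int) (j::int). True}"
  \<comment> \<open>Nontriviality of \<open>C\<close> enters here: if \<open>((0, 0), c)\<close> lay
    in \<open>?A\<close>, both exponents would vanish and \<open>c\<close> would be the
    identity.\<close>
  obtain c where c: "c \<in> carrier C" "c \<noteq> \<one>\<^bsub>C\<^esub>"
    using assms(3) C.trivial_group_subset by auto
  have "((0, 0), c) \<notin> ?A"
  proof
    assume "((0, 0), c) \<in> ?A"
    then obtain i j :: int where ij: "((0, 0), c) = a [^]\<^bsub>?G\<^esub> i \<otimes>\<^bsub>?G\<^esub> b [^]\<^bsub>?G\<^esub> j"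
      by blast
    then have "i = 0 \<and> j = 0"
      by (intro indep) (metis fst_conv)
    with ij c(2) show False by simp
  qed
  moreover have "((0, 0), c) \<in> generate ?G S"
    using S c by simp
  \<comment> \<open>If \<open>S\<close> lay in the subgroup \<open>?A\<close>, so would the whole
    group, including \<open>((0, 0), c)\<close>.\<close>
  ultimately have "\<not> S \<subseteq> ?A"
    using G.generate_subgroup_incl[OF _ G.subgroup_two_generators[OF closed]] by blast
  then obtain s where s: "s \<in> S" "s \<notin> ?A"
    by blast
  show ?thesis
  proof (rule G.cayley_graph_not_minor_excluded[OF assms(5,6) a(1) b(1) s(1)])
    fix i j :: int
    show "i = 0 \<and> j = 0" if "a [^]\<^bsub>?G\<^esub> i \<otimes>\<^bsub>?G\<^esub> b [^]\<^bsub>?G\<^esub> j = \<one>\<^bsub>?G\<^esub>"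
      using that by (intro indep) simp
    show "s \<noteq> a [^]\<^bsub>?G\<^esub> i \<otimes>\<^bsub>?G\<^esub> b [^]\<^bsub>?G\<^esub> j"
      using s(2) by blast
  qed
qed

end
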